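(* Let $\mathcal{G}_1$ and $\mathcal{G}_2$ be the graphs on the vertex set $\{1,2,\ldots,16\}$ defined below, and let $\mathfrak{G}=\mathcal{G}_1^2$ (which equals $\mathcal{G}_2^2$). If $H$ is a graph on the vertex set $\{1,\ldots,16\}$ with girth $g(H)=5$ and $H^2=\mathfrak{G}$, then $H$ is isomorphic either to $\mathcal{G}_1$ or to $\mathcal{G}_2$.
   Context: For a graph $H$, the square $H^2$ is the graph on the same vertex set in which distinct $x,y$ are adjacent iff their distance in $H$ is at most $2$. The girth $g(H)$ is the length of a shortest cycle of $H$. $\mathcal{G}_1$ has the 24 edges $1\text{-}7, 1\text{-}11, 1\text{-}12, 2\text{-}8, 2\text{-}12, 2\text{-}15, 3\text{-}9, 3\text{-}12, 3\text{-}16, 4\text{-}10, 4\text{-}14, 4\text{-}15, 5\text{-}11, 5\text{-}13, 5\text{-}15, 6\text{-}13, 6\text{-}14, 7\text{-}13, 8\text{-}14, 8\text{-}16, 9\text{-}15, 10\text{-}16, 11\text{-}14, 13\text{-}16$. $\mathcal{G}_2$ has the 24 edges $1\text{-}7, 1\text{-}11, 1\text{-}12, 2\text{-}8, 2\text{-}12, 2\text{-}16, 3\text{-}9, 3\text{-}12, 3\text{-}15, 4\text{-}10, 4\text{-}14, 4\text{-}16, 5\text{-}6, 5\text{-}7, 5\text{-}13, 5\text{-}16, 6\text{-}14, 8\text{-}14, 8\text{-}15, 9\text{-}16, 10\text{-}15, 11\text{-}13, 11\text{-}14, 13\text{-}15$. Both have girth $5$ and $\mathcal{G}_1^2=\mathcal{G}_2^2$.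 *)

theory Defs
  imports Main "HOL-Library.Extended_Nat"
begin

type_synonym 'a graph = "'a set \<times> 'a set set"

abbreviation verts :: "'a graph \<Rightarrow> 'a set" where
  "verts G \<equiv> fst G"

abbreviation edges :: "'a graph \<Rightarrow> 'a set set" where
  "edges G \<equiv> snd G"

definition simple_graph :: "'a graph \<Rightarrow> bool" where
  "simple_graph G \<longleftrightarrow> (\<forall>e \<in> edges G. e \<subseteq> verts G \<and> card e = 2)"

(* A walk is given by its nonempty list of vertices; a walk with n + 1 vertices has length n. *)
definition walk :: "'a graph \<Rightarrow> 'a list \<Rightarrow> bool" where
  "walk G xs \<longleftrightarrow> xs \<noteq> [] \<and> set xs \<subseteq> verts G \<and> successively (\<lambda>x y. {x, y} \<in> edges G) xs"

(* The distance is \<infinity> when no walk joins the two vertices. *)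
definition gdist :: "'a graph \<Rightarrow> 'a \<Rightarrow> 'a \<Rightarrow> enat" where
  "gdist G x y = (INF xs \<in> {xs. walk G xs \<and> hd xs = x \<and> last xs = y}. enat (length xs - 1))"

definition square :: "'a graph \<Rightarrow> 'a graph" where
  "square G =
     (verts G, {{x, y} | x y. x \<in> verts G \<and> y \<in> verts G \<and> x \<noteq> y \<and> gdist G x y \<le> 2})"

(* A cycle is given by the list of its vertices, the first one not being repeated at the end,
   so its length is the length of the list. *)
definition cycle :: "'a graph \<Rightarrow> 'a list \<Rightarrow> bool" where
  "cycle G xs \<longleftrightarrow>
     walk G xs \<and> distinct xs \<and> 3 \<le> length xs \<and> {last xs, hd xs} \<in> edges G"

(* The girth of an acyclic graph is \<infinity>. *)
definition girth :: "'a graph \<Rightarrow> enat" where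
  "girth G = (INF xs \<in> {xs. cycle G xs}. enat (length xs))"

definition graph_iso :: "'a graph \<Rightarrow> 'b graph \<Rightarrow> bool" where
  "graph_iso G G' \<longleftrightarrow>
     (\<exists>f. bij_betw f (verts G) (verts G') \<and>
          (\<forall>x \<in> verts G. \<forall>y \<in> verts G. {x, y} \<in> edges G \<longleftrightarrow> {f x, f y} \<in> edges G'))"

definition G1 :: "nat graph" where
  "G1 = ({1..16},
     {{1,7}, {1,11}, {1,12}, {2,8}, {2,12}, {2,15}, {3,9}, {3,12}, {3,16}, {4,10}, {4,14}, {4,15},
      {5,11}, {5,13}, {5,15}, {6,13}, {6,14}, {7,13}, {8,14}, {8,16}, {9,15}, {10,16}, {11,14},
      {13,16}})"

definition G2 :: "nat graph" where
  "G2 = ({1..16},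
     {{1,7}, {1,11}, {1,12}, {2,8}, {2,12}, {2,16}, {3,9}, {3,12}, {3,15}, {4,10}, {4,14}, {4,16},
      {5,6}, {5,7}, {5,13}, {5,16}, {6,14}, {8,14}, {8,15}, {9,16}, {10,15}, {11,13}, {11,14},
      {13,15}})"

end

theory Submission
  imports Defs
begin

text \<open>
  Two distinct vertices are adjacent in the square iff they are adjacent or have a common neighbour.
  Hence the edges of a square root \<open>H\<close> of \<open>square G1\<close> lie among the 76 edges of \<open>square G1\<close>, any
  two neighbours of a vertex in \<open>H\<close> are adjacent in \<open>square G1\<close>, and every edge of \<open>square G1\<close> is
  an edge of \<open>H\<close> or is covered by a path of length 2. Regarded as propositional constraints
  on these 76 edges, together with the absence of triangles, these conditions have exactly
  two solutions, the edge sets of \<open>G1\<close> and \<open>G2\<close>; so 4-cycles need not be excluded, and the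
  isomorphism is the identity.
\<close>

definition nbhd :: "'a graph \<Rightarrow> 'a \<Rightarrow> 'a set" where
  "nbhd G x = {y. {x, y} \<in> edges G}"

lemma edge_verts:
  assumes "simple_graph G" "{x, y} \<in> edges G"
  shows "x \<in> verts G" "y \<in> verts G"
  using assms by (auto simp: simple_graph_def)

text \<open>A walk of length at most 2 between distinct vertices is a single edge or passes through
  one middle vertex.\<close>

lemma gdist_le_2_iff:
  assumes "simple_graph G" "a \<noteq> b"
  shows "gdist G a b \<le> 2 \<longleftrightarrow> b \<in> nbhd G a \<union> \<Union> (nbhd G ` nbhd G a)"
proof
  let ?W = "{xs. walk G xs \<and> hd xs = a \<and> last xs = b}"
  assume le: "gdist G a b \<le> 2"
  \<comment> \<open>Over an empty set of walks the infimum would be \<infinity>; over a nonempty one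
    it is a least element, hence attained by some walk.\<close>
  have "?W \<noteq> {}"
  proof
    assume "?W = {}"
    with le show False by (simp only: gdist_def image_empty Inf_enat_def) simp
  qed
  then have "gdist G a b \<in> (\<lambda>xs. enat (length xs - 1)) ` ?W"
    unfolding gdist_def by (simp only: Inf_enat_def image_is_empty if_False) (rule LeastI_ex, blast)
  then obtain xs where xs: "walk G xs" "hd xs = a" "last xs = b" "length xs - 1 \<le> 2"
    using le by (auto simp: numeral_eq_enat)
  then consider "xs = [a]" | "xs = [a, b]" | z where "xs = [a, z, b]"
    by (cases xs; cases "tl xs"; cases "tl (tl xs)"; cases "tl (tl (tl xs))")
      (auto simp: walk_def)
  then show "b \<in> nbhd G a \<union> \<Union> (nbhd G ` nbhd G a)"
    using xs assms(2) by cases (auto simp: walk_def nbhd_def)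
next
  note vs = edge_verts[OF assms(1)]
  assume "b \<in> nbhd G a \<union> \<Union> (nbhd G ` nbhd G a)"
  then consider "{a, b} \<in> edges G" | z where "{a, z} \<in> edges G" "{z, b} \<in> edges G"
    by (auto simp: nbhd_def)
  then obtain xs where "walk G xs" "hd xs = a" "last xs = b" "length xs - 1 \<le> 2"
  proof cases
    case 1
    then show ?thesis using that[of "[a, b]"] vs by (auto simp: walk_def)
  next
    case 2
    then show ?thesis using that[of "[a, z, b]"] vs by (auto simp: walk_def)
  qed
  then show "gdist G a b \<le> 2"
    unfolding gdist_def by (intro INF_lower2[of xs]) (auto simp: numeral_eq_enat)
qed

lemma nbhd_square:
  assumes "simple_graph G"
  shows "nbhd (square G) x = (nbhd G x \<union> \<Union> (nbhd G ` nbhd G x)) - {x}"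
proof -
  note vs = edge_verts[OF assms]
  have comm: "{b, a} \<in> edges G" if "{a, b} \<in> edges G" for a b
    using that by (simp add: insert_commute)
  \<comment> \<open>An edge of \<open>square G\<close> is an unordered pair, so its distance bound
    may come with the ends in either order.\<close>
  have sym: "gdist G a b \<le> 2 \<longleftrightarrow> gdist G b a \<le> 2" if "a \<noteq> b" for a b
    using that by (auto simp: gdist_le_2_iff[OF assms] nbhd_def dest: comm)
  have "y \<in> nbhd (square G) x \<longleftrightarrow>
      x \<in> verts G \<and> y \<in> verts G \<and> x \<noteq> y \<and> gdist G x y \<le> 2" for y
    using sym by (auto simp: nbhd_def square_def doubleton_eq_iff)
  then show ?thesis
    using vs by (auto simp: gdist_le_2_iff[OF assms] nbhd_def)
qed

text \<open>A triangle is a cycle of length 3 and would bound the girth by 3.\<close>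

lemma no_triangle:
  assumes "simple_graph G" "girth G > 3" "{x, y} \<in> edges G" "{y, z} \<in> edges G"
  shows "{x, z} \<notin> edges G"
proof
  assume "{x, z} \<in> edges G"
  then have "cycle G [x, y, z]"
    using assms by (auto simp: cycle_def walk_def simple_graph_def insert_commute)
  then have "girth G \<le> enat (length [x, y, z])"
    unfolding girth_def by (intro INF_lower) simp
  with assms(2) show False
    by (simp add: numeral_eq_enat eval_nat_numeral)
qed

text \<open>The identity is an isomorphism. Pairs with \<open>x < y\<close> suffice, as edges are
  unordered and neither graph has loops.\<close>

lemma graph_iso_if_same_edges:
  fixes G :: "'a::linorder graph"
  assumes "simple_graph G" "simple_graph G'" "verts G = verts G'"
    and edges: "\<forall>x\<in>verts G. \<forall>y\<in>verts G. x < y \<longrightarrow> ({x, y} \<in> edges G \<longleftrightarrow> {x, y} \<in> edges G')"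
  shows "graph_iso G G'"
proof -
  have "{x, y} \<in> edges G \<longleftrightarrow> {x, y} \<in> edges G'" if "x \<in> verts G" "y \<in> verts G" for x y
  proof (cases x y rule: linorder_cases)
    case less
    then show ?thesis using edges that by blast
  next
    case equal
    then show ?thesis using assms(1,2) by (auto simp: simple_graph_def)
  next
    case greater
    then show ?thesis using edges that by (simp add: insert_commute[of x y])
  qed
  then show ?thesis
    unfolding graph_iso_def using assms(3) by (intro exI[of _ id]) simp
qed

lemma atLeastAtMost_1_16:
  "{1..16::nat} = {1, 2, 3, 4, 5, 6, 7, 8, 9, 10, 11, 12, 13, 14, 15, 16}"
  by (simp add: numeral_eq_Suc atLeastAtMostSuc_conv insert_commute)

lemma verts_G1: "verts G1 = {1..16}"
  by (simp add: G1_def)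

lemma verts_G2: "verts G2 = {1..16}"
  by (simp add: G2_def)

lemma simple_graph_G1: "simple_graph G1"
  by (simp add: simple_graph_def G1_def)

lemma simple_graph_G2: "simple_graph G2"
  by (simp add: simple_graph_def G2_def)

lemma nbhd_G1:
    "nbhd G1 1 = {7, 11, 12}"
    "nbhd G1 2 = {8, 12, 15}"
    "nbhd G1 3 = {9, 12, 16}"
    "nbhd G1 4 = {10, 14, 15}"
    "nbhd G1 5 = {11, 13, 15}"
    "nbhd G1 6 = {13, 14}"
    "nbhd G1 7 = {1, 13}"
    "nbhd G1 8 = {2, 14, 16}"
    "nbhd G1 9 = {3, 15}"
    "nbhd G1 10 = {4, 16}"
    "nbhd G1 11 = {1, 5, 14}"
    "nbhd G1 12 = {1, 2, 3}"
    "nbhd G1 13 = {5, 6, 7, 16}"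
    "nbhd G1 14 = {4, 6, 8, 11}"
    "nbhd G1 15 = {2, 4, 5, 9}"
    "nbhd G1 16 = {3, 8, 10, 13}"
  by (auto simp: nbhd_def G1_def doubleton_eq_iff)

lemma nbhd_square_G1:
    "nbhd (square G1) 1 = {2, 3, 5, 7, 11, 12, 13, 14}"
    "nbhd (square G1) 2 = {1, 3, 4, 5, 8, 9, 12, 14, 15, 16}"
    "nbhd (square G1) 3 = {1, 2, 8, 9, 10, 12, 13, 15, 16}"
    "nbhd (square G1) 4 = {2, 5, 6, 8, 9, 10, 11, 14, 15, 16}"
    "nbhd (square G1) 5 = {1, 2, 4, 6, 7, 9, 11, 13, 14, 15, 16}"
    "nbhd (square G1) 6 = {4, 5, 7, 8, 11, 13, 14, 16}"
    "nbhd (square G1) 7 = {1, 5, 6, 11, 12, 13, 16}"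
    "nbhd (square G1) 8 = {2, 3, 4, 6, 10, 11, 12, 13, 14, 15, 16}"
    "nbhd (square G1) 9 = {2, 3, 4, 5, 12, 15, 16}"
    "nbhd (square G1) 10 = {3, 4, 8, 13, 14, 15, 16}"
    "nbhd (square G1) 11 = {1, 4, 5, 6, 7, 8, 12, 13, 14, 15}"
    "nbhd (square G1) 12 = {1, 2, 3, 7, 8, 9, 11, 15, 16}"
    "nbhd (square G1) 13 = {1, 3, 5, 6, 7, 8, 10, 11, 14, 15, 16}"
    "nbhd (square G1) 14 = {1, 2, 4, 5, 6, 8, 10, 11, 13, 15, 16}"
    "nbhd (square G1) 15 = {2, 3, 4, 5, 8, 9, 10, 11, 12, 13, 14}"
    "nbhd (square G1) 16 = {2, 3, 4, 5, 6, 7, 8, 9, 10, 12, 13, 14}"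
  by (simp_all add: nbhd_square[OF simple_graph_G1] nbhd_G1 set_eq_subset insert_Diff_if del: One_nat_def)

theorem theorem1:
  fixes H :: "nat graph"
  assumes "simple_graph H"
    and "verts H = {1..16}"
    and "girth H = 5"
    and "square H = square G1"
  shows "graph_iso H G1 \<or> graph_iso H G2"
proof -
  let ?N = "nbhd (square G1)" and ?V = "{1..16::nat}"
  \<comment> \<open>The numeral \<open>1\<close> must not become \<open>Suc 0\<close>, or the table
    would not match at vertex 1.\<close>
  note nbhd_square_G1 [simp] One_nat_def [simp del]
  \<comment> \<open>As the squares coincide, the explicit sets \<open>?N x\<close> also describe the
    square of \<open>H\<close>.\<close>
  have N: "y \<in> ?N x \<longleftrightarrow>
      x \<noteq> y \<and> ({x, y} \<in> edges H \<or> (\<exists>z. {x, z} \<in> edges H \<and> {z, y} \<in> edges H))" for x y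
    unfolding nbhd_square[OF assms(1), unfolded assms(4)] by (auto simp: nbhd_def)
  have triangle_free: "\<not> ({x, y} \<in> edges H \<and> {y, z} \<in> edges H \<and> {x, z} \<in> edges H)" for x y z
    using no_triangle[OF assms(1)] assms(3) by (auto simp: numeral_eq_enat)
  have irrefl: "{x} \<notin> edges H" for x
    using assms(1) by (auto simp: simple_graph_def)
  \<comment> \<open>Writes every edge with its smaller end first, so that each edge is a single propositional atom.\<close>
  have swap [simp]: "y < x \<Longrightarrow> {x, y} \<in> edges H \<longleftrightarrow> {y, x} \<in> edges H" for x y :: nat
    by (simp add: insert_commute)
  \<comment> \<open>As simp rules, these facts leave only the 76 edges of the square as
    atoms.\<close>
  have "\<forall>x\<in>?V. \<forall>y\<in>?V. x < y \<longrightarrow> y \<notin> ?N x \<longrightarrow> {x, y} \<notin> edges H"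
    using N by blast
  note nonadj [simp] = this[unfolded atLeastAtMost_1_16, simplified]
  have "\<forall>y\<in>?V. \<forall>x\<in>?N y. \<forall>z\<in>?N y. x < z \<longrightarrow> z \<notin> ?N x \<longrightarrow>
      \<not> ({x, y} \<in> edges H \<and> {y, z} \<in> edges H)"
    using N by blast
  note path = this[unfolded atLeastAtMost_1_16, simplified]
  \<comment> \<open>Only triangles of the square can be triangles of \<open>H\<close>; the ordering
    lists each one once.\<close>
  have "\<forall>y\<in>?V. \<forall>x\<in>?N y. \<forall>z\<in>?N y. x < y \<longrightarrow> y < z \<longrightarrow> z \<in> ?N x \<longrightarrow>
      \<not> ({x, y} \<in> edges H \<and> {y, z} \<in> edges H \<and> {x, z} \<in> edges H)"
    using triangle_free by blast
  note triangle = this[unfolded atLeastAtMost_1_16, simplified]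
  \<comment> \<open>Confining the middle vertex to common neighbours in the square turns the
    existential into a finite disjunction.\<close>
  have "\<forall>x\<in>?V. \<forall>z\<in>?N x. x < z \<longrightarrow>
      {x, z} \<in> edges H \<or> (\<exists>y\<in>?N x \<inter> ?N z. {x, y} \<in> edges H \<and> {y, z} \<in> edges H)"
  proof (intro ballI impI)
    fix x z assume "z \<in> ?N x"
    then consider "{x, z} \<in> edges H" | y where "{x, y} \<in> edges H" "{y, z} \<in> edges H"
      using N by blast
    then show "{x, z} \<in> edges H \<or> (\<exists>y\<in>?N x \<inter> ?N z. {x, y} \<in> edges H \<and> {y, z} \<in> edges H)"
    proof cases
      case 2
      moreover have "x \<noteq> y" "z \<noteq> y" "{z, y} \<in> edges H"
        using 2 irrefl by (auto simp: insert_commute)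
      ultimately show ?thesis
        using N by blast
    qed simp
  qed
  note cover = this[unfolded atLeastAtMost_1_16, simplified]
  have "(\<forall>x\<in>?V. \<forall>y\<in>?V. x < y \<longrightarrow> ({x, y} \<in> edges H \<longleftrightarrow> {x, y} \<in> edges G1)) \<or>
      (\<forall>x\<in>?V. \<forall>y\<in>?V. x < y \<longrightarrow> ({x, y} \<in> edges H \<longleftrightarrow> {x, y} \<in> edges G2))"
    unfolding atLeastAtMost_1_16
    \<comment> \<open>Evaluating membership in the two explicit edge sets leaves a purely
      propositional goal about the edges of \<open>H\<close>.\<close>
    by (simp add: G1_def G2_def doubleton_eq_iff) (use path triangle cover in sat)
  then show ?thesis
    using graph_iso_if_same_edges[OF assms(1) simple_graph_G1]
      graph_iso_if_same_edges[OF assms(1) simple_graph_G2]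
    unfolding assms(2) verts_G1 verts_G2 by blast
qed

end
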